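(* Let $T,E\ge 1$ be integers, let $\delta_1,\dots,\delta_E\ge 0$ be integer lead times, let $\delta=\min_{e\in[E]}\delta_e$ and suppose $\delta\le T$. Let $c_{te},p_{te},Q_e,V_{\min},V_{\max},v_1\in\mathbb{R}$ ($t\in[T]$, $e\in[E]$) be given with $c_{te}>0$ for all $t\in[T]$, $e\in[E]$. Let $\mathcal{U}_t=[\underline{D}_t,\bar{D}_t]$ for $t\in[T+1]$, with $\underline{D}_1=\bar{D}_1=1$ and $\underline{D}_t<\bar{D}_t$ for all $t\ge 2$. Consider the linear decision rule problem for the production-inventory problem $$\begin{aligned} \min_{\mathbf y}\quad &\max_{\zeta_1\in\mathcal{U}_1,\dots,\zeta_{T+1}\in\mathcal{U}_{T+1}}\ \sum_{t=1}^T\sum_{e=1}^E c_{te}\Big(\sum_{s=1}^t y_{t,s,e}\zeta_s\Big)\\ \text{s.t.}\quad &\sum_{t=1}^T\sum_{s=1}^t y_{t,s,e}\zeta_s\le Q_e &&\forall e\in[E],\\ &0\le \sum_{s=1}^t y_{t,s,e}\zeta_s\le p_{te}&&\forall e\in[E],\ t\in[T],\\ &V_{\min}\le v_1+\sum_{e=1}^E\sum_{\ell=1}^{t-\delta_e}\sum_{s=1}^{\ell} y_{\ell,s,e}\zeta_s-\sum_{s=2}^{t+1}\zeta_s\le V_{\max}&&\forall t\in[T], \end{aligned}$$ where all constraints must hold for all $\zeta_1\in\mathcal{U}_1,\dots,\zeta_{T+1}\in\mathcal{U}_{T+1}$, and where the decision variables are $\mathbf y=(y_{t,s,e})_{1\le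 s\le t\le T,\ e\in[E]}$ with real entries. Suppose this problem is feasible and its optimal objective value is finite. Then it has an optimal solution $\bar{\mathbf y}$ that satisfies $$\|\bar{\mathbf y}\|_0\le 2+8E+10T+6E(T-\delta).$$
   Context: $[k]=\{1,\dots,k\}$. $\|\mathbf y\|_0$ denotes the number of nonzero scalar entries of $\mathbf y$. A sum $\sum_{\ell=1}^{t-\delta_e}$ with $t-\delta_e\le 0$ is empty (equal to $0$). *)

theory Defs
  imports Complex_Main "HOL-Library.FuncSet" "HOL-Library.Extended_Real"
begin

text \<open>
  A linear decision rule is a function \<open>y\<close> with \<open>y t s e\<close> the coefficient of \<open>\<zeta> s\<close> in the
  production quantity of facility \<open>e\<close> in period \<open>t\<close>. Only the entries indexed by
  \<open>ldr_index T E\<close> are decision variables; the values elsewhere are never used.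
\<close>

definition ldr_index :: "nat \<Rightarrow> nat \<Rightarrow> (nat \<times> nat \<times> nat) set" where
  "ldr_index T E = {(t, s, e). 1 \<le> s \<and> s \<le> t \<and> t \<le> T \<and> e \<in> {1..E}}"

definition l0_norm :: "nat \<Rightarrow> nat \<Rightarrow> (nat \<Rightarrow> nat \<Rightarrow> nat \<Rightarrow> real) \<Rightarrow> nat" where
  "l0_norm T E y = card {(t, s, e) \<in> ldr_index T E. y t s e \<noteq> 0}"

definition uncertainty_set :: "nat \<Rightarrow> (nat \<Rightarrow> real) \<Rightarrow> (nat \<Rightarrow> real) \<Rightarrow> (nat \<Rightarrow> real) set" where
  "uncertainty_set T Dlo Dhi = (\<Pi>\<^sub>E t\<in>{1..T+1}. {Dlo t..Dhi t})"

definition production :: "(nat \<Rightarrow> nat \<Rightarrow> nat \<Rightarrow> real) \<Rightarrow> (nat \<Rightarrow> real) \<Rightarrow> nat \<Rightarrow> nat \<Rightarrow> real" where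
  "production y \<zeta> t e = (\<Sum>s=1..t. y t s e * \<zeta> s)"

definition total_cost ::
  "nat \<Rightarrow> nat \<Rightarrow> (nat \<Rightarrow> nat \<Rightarrow> real) \<Rightarrow> (nat \<Rightarrow> nat \<Rightarrow> nat \<Rightarrow> real) \<Rightarrow> (nat \<Rightarrow> real) \<Rightarrow> real" where
  "total_cost T E c y \<zeta> = (\<Sum>t=1..T. \<Sum>e=1..E. c t e * production y \<zeta> t e)"

text \<open>
  The supremum below is a maximum whenever the intervals are nonempty;
  see \<open>worst_case_cost_attained\<close>.
\<close>

definition worst_case_cost ::
  "nat \<Rightarrow> nat \<Rightarrow> (nat \<Rightarrow> nat \<Rightarrow> real) \<Rightarrow> (nat \<Rightarrow> real) \<Rightarrow> (nat \<Rightarrow> real) \<Rightarrow>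
   (nat \<Rightarrow> nat \<Rightarrow> nat \<Rightarrow> real) \<Rightarrow> real" where
  "worst_case_cost T E c Dlo Dhi y =
     (SUP \<zeta>\<in>uncertainty_set T Dlo Dhi. total_cost T E c y \<zeta>)"

text \<open>
  For \<open>t \<le> \<delta> e\<close> the truncated subtraction makes \<open>{1..t - \<delta> e}\<close> empty.
\<close>

definition inventory ::
  "nat \<Rightarrow> (nat \<Rightarrow> nat) \<Rightarrow> real \<Rightarrow> (nat \<Rightarrow> nat \<Rightarrow> nat \<Rightarrow> real) \<Rightarrow> (nat \<Rightarrow> real) \<Rightarrow> nat \<Rightarrow> real" where
  "inventory E \<delta> v1 y \<zeta> t =
     v1 + (\<Sum>e=1..E. \<Sum>l=1..t - \<delta> e. production y \<zeta> l e) - (\<Sum>s=2..t+1. \<zeta> s)"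

definition ldr_feasible ::
  "nat \<Rightarrow> nat \<Rightarrow> (nat \<Rightarrow> nat) \<Rightarrow> (nat \<Rightarrow> nat \<Rightarrow> real) \<Rightarrow> (nat \<Rightarrow> real) \<Rightarrow>
   real \<Rightarrow> real \<Rightarrow> real \<Rightarrow> (nat \<Rightarrow> real) \<Rightarrow> (nat \<Rightarrow> real) \<Rightarrow>
   (nat \<Rightarrow> nat \<Rightarrow> nat \<Rightarrow> real) \<Rightarrow> bool" where
  "ldr_feasible T E \<delta> p Q Vmin Vmax v1 Dlo Dhi y \<longleftrightarrow>
     (\<forall>\<zeta>\<in>uncertainty_set T Dlo Dhi.
        (\<forall>e\<in>{1..E}. (\<Sum>t=1..T. production y \<zeta> t e) \<le> Q e) \<and>
        (\<forall>e\<in>{1..E}. \<forall>t\<in>{1..T}. 0 \<le> production y \<zeta> t e \<and> production y \<zeta> t e \<le> p t e) \<and>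
        (\<forall>t\<in>{1..T}. Vmin \<le> inventory E \<delta> v1 y \<zeta> t \<and> inventory E \<delta> v1 y \<zeta> t \<le> Vmax))"

text \<open>
  The value is an extended real, so that it is \<open>\<infinity>\<close> for an infeasible problem and
  \<open>-\<infinity>\<close> for an unbounded one.
\<close>

definition ldr_value ::
  "nat \<Rightarrow> nat \<Rightarrow> (nat \<Rightarrow> nat) \<Rightarrow> (nat \<Rightarrow> nat \<Rightarrow> real) \<Rightarrow> (nat \<Rightarrow> nat \<Rightarrow> real) \<Rightarrow> (nat \<Rightarrow> real) \<Rightarrow>
   real \<Rightarrow> real \<Rightarrow> real \<Rightarrow> (nat \<Rightarrow> real) \<Rightarrow> (nat \<Rightarrow> real) \<Rightarrow> ereal" where
  "ldr_value T E \<delta> c p Q Vmin Vmax v1 Dlo Dhi =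
     (INF y\<in>{y. ldr_feasible T E \<delta> p Q Vmin Vmax v1 Dlo Dhi y}.
        ereal (worst_case_cost T E c Dlo Dhi y))"

definition ldr_optimal ::
  "nat \<Rightarrow> nat \<Rightarrow> (nat \<Rightarrow> nat) \<Rightarrow> (nat \<Rightarrow> nat \<Rightarrow> real) \<Rightarrow> (nat \<Rightarrow> nat \<Rightarrow> real) \<Rightarrow> (nat \<Rightarrow> real) \<Rightarrow>
   real \<Rightarrow> real \<Rightarrow> real \<Rightarrow> (nat \<Rightarrow> real) \<Rightarrow> (nat \<Rightarrow> real) \<Rightarrow>
   (nat \<Rightarrow> nat \<Rightarrow> nat \<Rightarrow> real) \<Rightarrow> bool" where
  "ldr_optimal T E \<delta> c p Q Vmin Vmax v1 Dlo Dhi y \<longleftrightarrow>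
     is_arg_min (worst_case_cost T E c Dlo Dhi)
       (ldr_feasible T E \<delta> p Q Vmin Vmax v1 Dlo Dhi) y"

lemma total_cost_maximizer:
  assumes "\<And>t. t \<in> {1..T+1} \<Longrightarrow> Dlo t \<le> Dhi t"
  obtains \<zeta> where "\<zeta> \<in> uncertainty_set T Dlo Dhi"
    and "\<And>\<xi>. \<xi> \<in> uncertainty_set T Dlo Dhi \<Longrightarrow> total_cost T E c y \<xi> \<le> total_cost T E c y \<zeta>"
proof -
  define a where "a s = (\<Sum>t=s..T. \<Sum>e=1..E. c t e * y t s e)" for s
  define \<zeta> where "\<zeta> = restrict (\<lambda>s. if a s \<ge> 0 then Dhi s else Dlo s) {1..T+1}"
  have eq: "total_cost T E c y \<xi> = (\<Sum>s=1..T. a s * \<xi> s)" for \<xi>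
  proof -
    have "total_cost T E c y \<xi> = (\<Sum>t=1..T. \<Sum>s=1..t. (\<Sum>e=1..E. c t e * y t s e) * \<xi> s)"
      unfolding total_cost_def production_def
    proof (rule sum.cong[OF refl])
      fix t
      show "(\<Sum>e=1..E. c t e * (\<Sum>s=1..t. y t s e * \<xi> s)) =
          (\<Sum>s=1..t. (\<Sum>e=1..E. c t e * y t s e) * \<xi> s)"
        unfolding sum_distrib_left sum_distrib_right mult.assoc by (rule sum.swap)
    qed
    also have "\<dots> = (\<Sum>s=1..T. \<Sum>t=s..T. (\<Sum>e=1..E. c t e * y t s e) * \<xi> s)"
      by (subst (1 2) sum.Sigma; (simp; fail)?)
         (rule sum.reindex_bij_witness[of _ "\<lambda>(s, t). (t, s)" "\<lambda>(t, s). (s, t)"]; auto)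
    finally show ?thesis by (simp add: a_def sum_distrib_right)
  qed
  show thesis
  proof
    show "\<zeta> \<in> uncertainty_set T Dlo Dhi"
      using assms by (auto simp: \<zeta>_def uncertainty_set_def)
    fix \<xi> assume "\<xi> \<in> uncertainty_set T Dlo Dhi"
    then have b: "Dlo s \<le> \<xi> s \<and> \<xi> s \<le> Dhi s" if "s \<in> {1..T}" for s
      using that by (auto simp: uncertainty_set_def PiE_iff)
    have "a s * \<xi> s \<le> a s * \<zeta> s" if "s \<in> {1..T}" for s
      using b[OF that] that by (auto simp: \<zeta>_def intro: mult_left_mono mult_left_mono_neg)
    then show "total_cost T E c y \<xi> \<le> total_cost T E c y \<zeta>"
      unfolding eq by (rule sum_mono)
  qed
qed

lemma worst_case_cost_attained:
  assumes "\<And>t. t \<in> {1..T+1} \<Longrightarrow> Dlo t \<le> Dhi t"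
  obtains \<zeta> where "\<zeta> \<in> uncertainty_set T Dlo Dhi"
    and "worst_case_cost T E c Dlo Dhi y = total_cost T E c y \<zeta>"
    and "\<And>\<xi>. \<xi> \<in> uncertainty_set T Dlo Dhi \<Longrightarrow> total_cost T E c y \<xi> \<le> total_cost T E c y \<zeta>"
proof -
  obtain \<zeta> where "\<zeta> \<in> uncertainty_set T Dlo Dhi"
    and "\<And>\<xi>. \<xi> \<in> uncertainty_set T Dlo Dhi \<Longrightarrow> total_cost T E c y \<xi> \<le> total_cost T E c y \<zeta>"
    using total_cost_maximizer[of T Dlo Dhi E c y] assms by blast
  moreover from this have "worst_case_cost T E c Dlo Dhi y = total_cost T E c y \<zeta>"
    unfolding worst_case_cost_def by (intro cSup_eq_maximum) auto
  ultimately show thesis using that by blast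
qed

end

theory Submission
  imports Defs "HOL-Analysis.Function_Topology"
begin

text \<open>
  The bound is a count of equations at an extreme point of the set of optimal rules.

  Let \<open>N\<close> be \<open>T\<close> minus the smallest lead time. Production in a period after \<open>N\<close> arrives too late for every inventory
  constraint, and since production is nonnegative and costs are positive, setting it to zero
  keeps a rule feasible and does not raise its cost (\<open>feasible_truncate\<close>, \<open>cost_truncate_le\<close>).
  So rules supported on periods up to \<open>N\<close> suffice. The capacity constraints together with the
  nondegenerate intervals bound every coefficient, so these feasible rules form a compact set,
  and an optimal rule exists. Among the optimal ones, a rule \<open>x\<close> of largest Euclidean norm is
  extreme: if \<open>x + k d\<close> stays feasible with the same cost for all \<open>k\<close> near \<open>0\<close>, then \<open>d = 0\<close>
  (\<open>extreme_optimal_rule\<close>).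

  Each constraint, and the objective, is the maximum of \<open>\<Sum>s. a s * \<zeta> s\<close> over the box, where \<open>a\<close>
  depends affinely on the rule. This maximum equals \<open>\<Sum>s. a s * corner s\<close>, where the maximizing
  corner depends only on the signs of the \<open>a s\<close>. It therefore stays constant along a direction
  \<open>d\<close> which does not move the vanishing coefficients away from zero and satisfies one further
  linear equation, namely that the change of \<open>a\<close> is orthogonal to the corner
  (\<open>box_support_locally_constant\<close>). So extremality says that a finite homogeneous linear system
  has no nonzero solution \<open>d\<close> supported on the support of \<open>x\<close>, and such a system has at least
  as many equations as \<open>x\<close> has nonzero entries (\<open>small_system_nontrivial_kernel\<close>).

  It remains to count equations. The objective takes \<open>N\<close>, the production totals \<open>E N\<close>, the
  production bounds \<open>2 E N\<close> (a vanishing coefficient there is a zero entry of \<open>x\<close>, which \<open>d\<close>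
  respects anyway) and the inventory bounds \<open>2 T\<close>. There are also about \<open>T N\<close> pairs \<open>(t, s)\<close> at
  which the coefficient of \<open>\<zeta> s\<close> in the inventory of period \<open>t\<close> may vanish, which looks like too
  many. But for fixed \<open>s\<close> such a vanishing says that the entries \<open>x (l, s, e)\<close> delivered by
  period \<open>t\<close> sum to \<open>1\<close>. The corresponding sets of nonzero entries form a chain, and two
  different sets in the chain differ by at least two entries, since one nonzero entry alone does
  not sum to \<open>0\<close>. Hence \<open>s\<close> contributes at most half of its nonzero entries, plus one half
  (\<open>card_chain_equal_sums\<close>). If \<open>n\<close> is the number of nonzero entries, this gives
  \<open>n \<le> N + 3 E N + 2 T + (n + N) / 2\<close>, that is, \<open>n \<le> 3 N + 4 T + 6 E N\<close>.
\<close>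

section \<open>Robust linear constraints over a box\<close>

definition box_support :: "(nat \<Rightarrow> real) \<Rightarrow> (nat \<Rightarrow> real) \<Rightarrow> nat \<Rightarrow> (nat \<Rightarrow> real) \<Rightarrow> real" where
  "box_support lo hi n a = (\<Sum>s=1..n. max (a s * lo s) (a s * hi s))"

definition corner :: "(nat \<Rightarrow> real) \<Rightarrow> (nat \<Rightarrow> real) \<Rightarrow> (nat \<Rightarrow> real) \<Rightarrow> nat \<Rightarrow> real" where
  "corner lo hi a s = (if 0 \<le> a s then hi s else lo s)"

lemma max_eq_corner:
  assumes "lo s \<le> hi s"
  shows "max (a s * lo s) (a s * hi s) = a s * corner lo hi a s"
  using assms by (auto simp: corner_def max_def mult_le_cancel_left)

lemma box_support_le_iff:
  assumes "\<And>s. s \<in> {1..n} \<Longrightarrow> lo s \<le> hi s"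
  shows "(\<forall>\<zeta>\<in>(\<Pi>\<^sub>E s\<in>{1..n}. {lo s..hi s}). (\<Sum>s=1..n. a s * \<zeta> s) \<le> b) \<longleftrightarrow>
    box_support lo hi n a \<le> b" (is "?L \<longleftrightarrow> ?R")
proof
  assume L: ?L
  have "restrict (corner lo hi a) {1..n} \<in> (\<Pi>\<^sub>E s\<in>{1..n}. {lo s..hi s})"
    using assms by (auto simp: corner_def)
  with L have "(\<Sum>s=1..n. a s * restrict (corner lo hi a) {1..n} s) \<le> b"
    by blast
  also have "(\<Sum>s=1..n. a s * restrict (corner lo hi a) {1..n} s) = box_support lo hi n a"
    unfolding box_support_def using assms by (intro sum.cong) (auto simp: max_eq_corner)
  finally show ?R .
next
  assume R: ?R
  show ?L
  proof
    fix \<zeta> assume \<zeta>: "\<zeta> \<in> (\<Pi>\<^sub>E s\<in>{1..n}. {lo s..hi s})"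
    have "(\<Sum>s=1..n. a s * \<zeta> s) \<le> box_support lo hi n a"
      unfolding box_support_def
    proof (rule sum_mono)
      fix s assume "s \<in> {1..n}"
      with \<zeta> have "\<zeta> s \<in> {lo s..hi s}" by (rule PiE_mem)
      then show "a s * \<zeta> s \<le> max (a s * lo s) (a s * hi s)"
        by (cases "0 \<le> a s")
          (auto simp: le_max_iff_disj intro: mult_left_mono mult_left_mono_neg)
    qed
    with R show "(\<Sum>s=1..n. a s * \<zeta> s) \<le> b" by simp
  qed
qed

text \<open>
  The maximizing corner stays a maximizer for small \<open>k\<close>: coefficients that are nonzero keep
  their sign, and those that are zero stay zero, except where the interval is a single point and
  both ends give the same value. With a fixed corner the support function is affine in \<open>k\<close>, and
  \<open>ortho\<close> says that its slope vanishes.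
\<close>

lemma box_support_locally_constant:
  assumes le: "\<And>s. s \<in> {1..n} \<Longrightarrow> lo s \<le> hi s"
    and vanish: "\<And>s. s \<in> {1..n} \<Longrightarrow> lo s < hi s \<Longrightarrow> a s = 0 \<Longrightarrow> g s = 0"
    and ortho: "(\<Sum>s=1..n. g s * corner lo hi a s) = 0"
  shows "\<forall>\<^sub>F k in nhds 0. box_support lo hi n (\<lambda>s. a s + k * g s) = box_support lo hi n a"
proof -
  have "\<forall>\<^sub>F k in nhds 0. \<forall>s\<in>{1..n}. max ((a s + k * g s) * lo s) ((a s + k * g s) * hi s)
      = (a s + k * g s) * corner lo hi a s"
  proof (rule eventually_ball_finite, simp, intro ballI)
    fix s assume s: "s \<in> {1..n}"
    have lim: "((\<lambda>k. a s + k * g s) \<longlongrightarrow> a s + 0 * g s) (nhds 0)"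
      by (intro tendsto_intros filterlim_ident)
    consider "lo s = hi s" | "a s = 0" "g s = 0" | "a s > 0" | "a s < 0"
      using vanish[OF s] le[OF s] by linarith
    then show "\<forall>\<^sub>F k in nhds 0. max ((a s + k * g s) * lo s) ((a s + k * g s) * hi s)
        = (a s + k * g s) * corner lo hi a s"
    proof cases
      case 1
      then show ?thesis by (simp add: corner_def)
    next
      case 2
      then show ?thesis by simp
    next
      case 3
      then have "\<forall>\<^sub>F k in nhds 0. 0 < a s + k * g s"
        using order_tendstoD(1)[OF lim] by simp
      then show ?thesis
        by eventually_elim
          (use 3 le[OF s] in \<open>simp add: corner_def max_def mult_le_cancel_left\<close>)
    next
      case 4
      then have "\<forall>\<^sub>F k in nhds 0. a s + k * g s < 0"
        using order_tendstoD(2)[OF lim] by simp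
      then show ?thesis
        by eventually_elim
          (use 4 le[OF s] in \<open>simp add: corner_def max_def mult_le_cancel_left\<close>)
    qed
  qed
  then show ?thesis
  proof eventually_elim
    case (elim k)
    have "box_support lo hi n (\<lambda>s. a s + k * g s) =
        (\<Sum>s=1..n. (a s + k * g s) * corner lo hi a s)"
      unfolding box_support_def using elim by (intro sum.cong) auto
    also have "\<dots> = (\<Sum>s=1..n. a s * corner lo hi a s) + k * (\<Sum>s=1..n. g s * corner lo hi a s)"
      by (simp add: distrib_right sum.distrib sum_distrib_left mult.assoc)
    also have "\<dots> = box_support lo hi n a"
      unfolding box_support_def ortho using le by (simp add: max_eq_corner)
    finally show ?case .
  qed
qed

lemma continuous_on_box_support:
  fixes \<alpha> :: "'a::topological_space \<Rightarrow> nat \<Rightarrow> real"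
  assumes "\<And>s. continuous_on A (\<lambda>x. \<alpha> x s)"
  shows "continuous_on A (\<lambda>x. box_support lo hi n (\<alpha> x))"
  unfolding box_support_def by (intro continuous_intros assms)

text \<open>
  The two support values add up to the range of \<open>\<Sum>s. a s * \<zeta> s\<close> over the box, which is
  \<open>\<Sum>s. \<bar>a s\<bar> * (hi s - lo s)\<close>; each summand is at most this sum.
\<close>

lemma coefficient_bound:
  assumes le: "\<And>s. s \<in> {1..n} \<Longrightarrow> lo s \<le> hi s"
    and s: "s \<in> {1..n}"
    and up: "box_support lo hi n a \<le> u" and low: "box_support lo hi n (\<lambda>s. - a s) \<le> l"
  shows "\<bar>a s\<bar> * (hi s - lo s) \<le> u + l"
proof -
  have width: "\<bar>a r\<bar> * (hi r - lo r) =
      max (a r * lo r) (a r * hi r) + max (- a r * lo r) (- a r * hi r)"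
    if "r \<in> {1..n}" for r
    using le[OF that] by (auto simp: max_def abs_if mult_le_cancel_left algebra_simps)
  have "\<bar>a s\<bar> * (hi s - lo s) \<le> (\<Sum>r=1..n. \<bar>a r\<bar> * (hi r - lo r))"
    using s le by (intro member_le_sum) auto
  also have "\<dots> = box_support lo hi n a + box_support lo hi n (\<lambda>s. - a s)"
    unfolding box_support_def sum.distrib[symmetric] by (intro sum.cong refl width)
  finally show ?thesis using up low by simp
qed

section \<open>Linear forms and homogeneous systems\<close>

definition linear_form :: "(('i \<Rightarrow> real) \<Rightarrow> real) \<Rightarrow> bool" where
  "linear_form \<phi> \<longleftrightarrow> (\<forall>x d k. \<phi> (\<lambda>i. x i + k * d i) = \<phi> x + k * \<phi> d)"

lemma linear_form_add: "linear_form \<phi> \<Longrightarrow> \<phi> (\<lambda>i. x i + k * d i) = \<phi> x + k * \<phi> d"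
  by (simp add: linear_form_def)

lemma linear_form_intros:
  "linear_form (\<lambda>x. x i)"
  "linear_form (\<lambda>x. 0)"
  "linear_form \<phi> \<Longrightarrow> linear_form (\<lambda>x. \<phi> x * r)"
  "linear_form \<phi> \<Longrightarrow> linear_form (\<lambda>x. r * \<phi> x)"
  "(\<And>j. j \<in> J \<Longrightarrow> linear_form (\<psi> j)) \<Longrightarrow> linear_form (\<lambda>x. \<Sum>j\<in>J. \<psi> j x)"
  by (simp_all add: linear_form_def algebra_simps sum.distrib sum_distrib_left)

text \<open>
  When a form \<open>\<phi>\<close> is added, the induction hypothesis on two smaller index sets gives two linearly
  independent solutions of the old system: \<open>d2\<close> is taken to vanish at a point \<open>i\<close> where \<open>d1\<close>
  does not. Some nonzero combination of them is then also annihilated by \<open>\<phi>\<close>.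
\<close>

lemma small_system_nontrivial_kernel:
  assumes "finite F" "finite S" "card F < card S" "\<And>\<phi>. \<phi> \<in> F \<Longrightarrow> linear_form \<phi>"
  shows "\<exists>d. (\<exists>i. d i \<noteq> 0) \<and> (\<forall>i. i \<notin> S \<longrightarrow> d i = 0) \<and> (\<forall>\<phi>\<in>F. \<phi> d = 0)"
  using assms
proof (induction F arbitrary: S rule: finite_induct)
  case empty
  then obtain j where "j \<in> S" by fastforce
  then show ?case
    by (intro exI[of _ "\<lambda>i. if i = j then 1 else 0"]) auto
next
  case (insert \<phi> F)
  have smaller: "\<exists>d. (\<exists>i. d i \<noteq> 0) \<and> (\<forall>i. i \<notin> S - {j} \<longrightarrow> d i = 0) \<and> (\<forall>\<psi>\<in>F. \<psi> d = 0)"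
    for j
  proof (rule insert.IH)
    show "card F < card (S - {j})"
      using insert.prems insert.hyps by (cases "j \<in> S") auto
  qed (use insert.prems in auto)
  obtain d1 i where d1: "d1 i \<noteq> 0" "\<And>i. i \<notin> S \<Longrightarrow> d1 i = 0" "\<And>\<psi>. \<psi> \<in> F \<Longrightarrow> \<psi> d1 = 0"
    using smaller[of undefined] by blast
  obtain d2 i' where d2: "d2 i' \<noteq> 0" "d2 i = 0" "\<And>i. i \<notin> S \<Longrightarrow> d2 i = 0"
      "\<And>\<psi>. \<psi> \<in> F \<Longrightarrow> \<psi> d2 = 0"
    using smaller[of i] by blast
  show ?case
  proof (cases "\<phi> d1 = 0")
    case True
    with d1 show ?thesis by blast
  next
    case False
    define k where "k = - (\<phi> d2 / \<phi> d1)"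
    define d where "d = (\<lambda>j. d2 j + k * d1 j)"
    have lin: "\<psi> d = \<psi> d2 + k * \<psi> d1" if "\<psi> \<in> insert \<phi> F" for \<psi>
      unfolding d_def using insert.prems(3)[OF that] by (rule linear_form_add)
    have "\<forall>\<psi>\<in>insert \<phi> F. \<psi> d = 0"
      using False by (auto simp: lin k_def d1(3) d2(4))
    moreover have "\<exists>j. d j \<noteq> 0"
    proof (cases "k = 0")
      case True
      with d2(1) show ?thesis by (auto simp: d_def)
    next
      case False
      with d1(1) d2(2) have "d i \<noteq> 0" by (simp add: d_def)
      then show ?thesis by blast
    qed
    moreover have "\<forall>j. j \<notin> S \<longrightarrow> d j = 0"
      using d1(2) d2(3) by (simp add: d_def)
    ultimately show ?thesis by blast
  qed
qed

text \<open>
  If \<open>A \<subset> B\<close> are in the chain, then \<open>w\<close> sums to \<open>0\<close> over \<open>B - A\<close>, so \<open>B - A\<close> is not a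
  singleton. Thus the sizes of the members are pairwise at least two apart, and the smallest is
  at least one because \<open>r \<noteq> 0\<close>.
\<close>

lemma card_chain_equal_sums:
  fixes w :: "'i \<Rightarrow> real"
  assumes fin: "finite S" and sub: "\<And>B. B \<in> \<B> \<Longrightarrow> B \<subseteq> S"
    and chain: "\<And>A B. A \<in> \<B> \<Longrightarrow> B \<in> \<B> \<Longrightarrow> A \<subseteq> B \<or> B \<subseteq> A"
    and nz: "\<And>i. i \<in> S \<Longrightarrow> w i \<noteq> 0"
    and sums: "\<And>B. B \<in> \<B> \<Longrightarrow> sum w B = r" and "r \<noteq> 0"
  shows "2 * card \<B> \<le> card S + 1"
proof -
  have gap: "card A + 2 \<le> card B" if "A \<in> \<B>" "B \<in> \<B>" "A \<subset> B" for A B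
  proof -
    have fB: "finite B" using sub[OF that(2)] fin finite_subset by blast
    have 0: "sum w (B - A) = 0"
      using that sums by (simp add: sum_diff fB psubset_imp_subset)
    have "card (B - A) \<noteq> 0"
      using that fB by auto
    moreover have "card (B - A) \<noteq> 1"
    proof
      assume "card (B - A) = 1"
      then obtain i where i: "B - A = {i}" by (rule card_1_singletonE)
      with 0 have "w i = 0" by simp
      moreover have "i \<in> S" using i sub[OF that(2)] by blast
      ultimately show False using nz by blast
    qed
    moreover have "card B = card A + card (B - A)"
      using that fB by (metis card_Diff_subset card_mono finite_subset le_add_diff_inverse psubset_imp_subset)
    ultimately show ?thesis by linarith
  qed
  \<comment> \<open>Sizes two apart have different rounded halves, so these halves number the chain.\<close>
  have inj: "inj_on (\<lambda>B. (card B + 1) div 2) \<B>"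
  proof (rule inj_onI, rule ccontr)
    fix A B assume AB: "A \<in> \<B>" "B \<in> \<B>" "(card A + 1) div 2 = (card B + 1) div 2" "A \<noteq> B"
    then have "card A + 2 \<le> card B \<or> card B + 2 \<le> card A"
      using chain[OF AB(1,2)] gap by blast
    with AB(3) show False by linarith
  qed
  have "(\<lambda>B. (card B + 1) div 2) ` \<B> \<subseteq> {1..(card S + 1) div 2}"
  proof (rule image_subsetI)
    fix B assume B: "B \<in> \<B>"
    have "B \<noteq> {}" using sums[OF B] \<open>r \<noteq> 0\<close> by auto
    moreover have "finite B" using sub[OF B] fin finite_subset by blast
    ultimately have "card B \<ge> 1" by (simp add: Suc_leI card_gt_0_iff)
    moreover have "card B \<le> card S" using sub[OF B] fin by (rule card_mono[rotated])
    ultimately show "(card B + 1) div 2 \<in> {1..(card S + 1) div 2}"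
      by (simp add: div_le_mono)
  qed
  from card_inj_on_le[OF inj this] have "card \<B> \<le> (card S + 1) div 2"
    by simp
  then show ?thesis by linarith
qed

section \<open>The robust counterpart\<close>

locale production_inventory =
  fixes T E :: nat and \<delta> :: "nat \<Rightarrow> nat" and c p :: "nat \<Rightarrow> nat \<Rightarrow> real"
    and Q :: "nat \<Rightarrow> real" and Vmin Vmax v1 :: real and Dlo Dhi :: "nat \<Rightarrow> real"
  assumes c_pos: "\<And>t e. t \<in> {1..T} \<Longrightarrow> e \<in> {1..E} \<Longrightarrow> c t e > 0"
    and Dlo_1: "Dlo 1 = 1" and Dhi_1: "Dhi 1 = 1"
    and D_less: "\<And>t. t \<in> {2..T+1} \<Longrightarrow> Dlo t < Dhi t"
begin

abbreviation feasible :: "(nat \<Rightarrow> nat \<Rightarrow> nat \<Rightarrow> real) \<Rightarrow> bool" where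
  "feasible \<equiv> ldr_feasible T E \<delta> p Q Vmin Vmax v1 Dlo Dhi"

abbreviation cost :: "(nat \<Rightarrow> nat \<Rightarrow> nat \<Rightarrow> real) \<Rightarrow> real" where
  "cost \<equiv> worst_case_cost T E c Dlo Dhi"

text \<open>
  Rules are taken as functions of one triple, so that the product topology and linear forms apply
  to them directly.
\<close>

abbreviation rule_of :: "(nat \<times> nat \<times> nat \<Rightarrow> real) \<Rightarrow> nat \<Rightarrow> nat \<Rightarrow> nat \<Rightarrow> real" where
  "rule_of x \<equiv> \<lambda>t s e. x (t, s, e)"

abbreviation support :: "(nat \<Rightarrow> real) \<Rightarrow> real" where
  "support \<equiv> box_support Dlo Dhi (T + 1)"

text \<open>
  Extending the coefficients of \<open>\<zeta> s\<close> by zero to all \<open>s\<close> turns every constraint into a sum over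
  the same index set \<open>{1..T+1}\<close>, hence into a support function of the same box.
\<close>

definition prod_coeff :: "(nat \<times> nat \<times> nat \<Rightarrow> real) \<Rightarrow> nat \<Rightarrow> nat \<Rightarrow> nat \<Rightarrow> real" where
  "prod_coeff x t e s = (if s \<le> t then x (t, s, e) else 0)"

definition total_coeff :: "(nat \<times> nat \<times> nat \<Rightarrow> real) \<Rightarrow> nat \<Rightarrow> nat \<Rightarrow> real" where
  "total_coeff x e s = (\<Sum>t=1..T. prod_coeff x t e s)"

definition cost_coeff :: "(nat \<times> nat \<times> nat \<Rightarrow> real) \<Rightarrow> nat \<Rightarrow> real" where
  "cost_coeff x s = (\<Sum>t=1..T. \<Sum>e=1..E. c t e * prod_coeff x t e s)"

definition delivered_coeff :: "(nat \<times> nat \<times> nat \<Rightarrow> real) \<Rightarrow> nat \<Rightarrow> nat \<Rightarrow> real" where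
  "delivered_coeff x t s = (\<Sum>e=1..E. \<Sum>l=1..t - \<delta> e. prod_coeff x l e s)"

definition inv_coeff :: "(nat \<times> nat \<times> nat \<Rightarrow> real) \<Rightarrow> nat \<Rightarrow> nat \<Rightarrow> real" where
  "inv_coeff x t s = delivered_coeff x t s - (if s \<in> {2..t+1} then 1 else 0)"

lemma linear_form_coeffs:
  "linear_form (\<lambda>x. prod_coeff x t e s)"
  "linear_form (\<lambda>x. total_coeff x e s)"
  "linear_form (\<lambda>x. cost_coeff x s)"
  "linear_form (\<lambda>x. delivered_coeff x t s)"
proof -
  show prod: "linear_form (\<lambda>x. prod_coeff x t e s)" for t e
    unfolding prod_coeff_def by (cases "s \<le> t") (simp_all add: linear_form_intros)
  show "linear_form (\<lambda>x. total_coeff x e s)" "linear_form (\<lambda>x. cost_coeff x s)"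
    "linear_form (\<lambda>x. delivered_coeff x t s)"
    unfolding total_coeff_def cost_coeff_def delivered_coeff_def
    by (intro linear_form_intros prod)+
qed

lemma continuous_on_coeffs:
  "continuous_on A (\<lambda>x. prod_coeff x t e s)"
  "continuous_on A (\<lambda>x. total_coeff x e s)"
  "continuous_on A (\<lambda>x. cost_coeff x s)"
  "continuous_on A (\<lambda>x. inv_coeff x t s)"
proof -
  have coord: "continuous_on A (\<lambda>x::nat \<times> nat \<times> nat \<Rightarrow> real. x i)" for i
    by (rule continuous_on_subset[OF continuous_on_product_coordinates subset_UNIV])
  show prod: "continuous_on A (\<lambda>x. prod_coeff x t e s)" for t e
    unfolding prod_coeff_def by (cases "s \<le> t") (simp_all add: coord)
  show "continuous_on A (\<lambda>x. total_coeff x e s)" "continuous_on A (\<lambda>x. cost_coeff x s)"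
    "continuous_on A (\<lambda>x. inv_coeff x t s)"
    unfolding total_coeff_def cost_coeff_def inv_coeff_def delivered_coeff_def
    by (intro continuous_intros prod)+
qed

lemma production_eq:
  assumes "t \<le> T"
  shows "production (rule_of x) \<zeta> t e = (\<Sum>s=1..T+1. prod_coeff x t e s * \<zeta> s)"
  unfolding production_def prod_coeff_def using assms
  by (intro sum.mono_neutral_cong_left) auto

lemma total_production_eq:
  "(\<Sum>t=1..T. production (rule_of x) \<zeta> t e) = (\<Sum>s=1..T+1. total_coeff x e s * \<zeta> s)"
  unfolding total_coeff_def sum_distrib_right
  by (subst sum.swap) (simp add: production_eq)

lemma total_cost_eq:
  "total_cost T E c (rule_of x) \<zeta> = (\<Sum>s=1..T+1. cost_coeff x s * \<zeta> s)"
proof -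
  have "total_cost T E c (rule_of x) \<zeta> =
      (\<Sum>t=1..T. \<Sum>e=1..E. \<Sum>s=1..T+1. c t e * prod_coeff x t e s * \<zeta> s)"
    unfolding total_cost_def
    by (intro sum.cong refl) (simp add: production_eq sum_distrib_left mult.assoc del: sum.cl_ivl_Suc)
  also have "\<dots> = (\<Sum>t=1..T. \<Sum>s=1..T+1. \<Sum>e=1..E. c t e * prod_coeff x t e s * \<zeta> s)"
    by (intro sum.cong refl sum.swap)
  also have "\<dots> = (\<Sum>s=1..T+1. \<Sum>t=1..T. \<Sum>e=1..E. c t e * prod_coeff x t e s * \<zeta> s)"
    by (rule sum.swap)
  finally show ?thesis by (simp only: cost_coeff_def sum_distrib_right)
qed

lemma inventory_eq:
  assumes "t \<le> T"
  shows "inventory E \<delta> v1 (rule_of x) \<zeta> t = v1 + (\<Sum>s=1..T+1. inv_coeff x t s * \<zeta> s)"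
proof -
  have "(\<Sum>e=1..E. \<Sum>l=1..t - \<delta> e. production (rule_of x) \<zeta> l e) =
      (\<Sum>e=1..E. \<Sum>l=1..t - \<delta> e. \<Sum>s=1..T+1. prod_coeff x l e s * \<zeta> s)"
    using assms by (intro sum.cong refl production_eq) auto
  also have "\<dots> = (\<Sum>e=1..E. \<Sum>s=1..T+1. \<Sum>l=1..t - \<delta> e. prod_coeff x l e s * \<zeta> s)"
    by (intro sum.cong refl sum.swap)
  also have "\<dots> = (\<Sum>s=1..T+1. \<Sum>e=1..E. \<Sum>l=1..t - \<delta> e. prod_coeff x l e s * \<zeta> s)"
    by (rule sum.swap)
  also have "\<dots> = (\<Sum>s=1..T+1. delivered_coeff x t s * \<zeta> s)"
    by (simp only: delivered_coeff_def sum_distrib_right)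
  finally have deliv: "(\<Sum>e=1..E. \<Sum>l=1..t - \<delta> e. production (rule_of x) \<zeta> l e) =
      (\<Sum>s=1..T+1. delivered_coeff x t s * \<zeta> s)" .
  have "(\<Sum>s=2..t+1. \<zeta> s) = (\<Sum>s=1..T+1. (if s \<in> {2..t+1} then 1 else 0) * \<zeta> s)"
    using assms by (intro sum.mono_neutral_cong_left) auto
  then show ?thesis
    unfolding inventory_def deliv inv_coeff_def left_diff_distrib sum_subtractf by simp
qed

lemma Dlo_le_Dhi: "s \<in> {1..T+1} \<Longrightarrow> Dlo s \<le> Dhi s"
  using D_less[of s] Dlo_1 Dhi_1 by (cases "s = 1") auto

lemma robust_le_iff:
  "(\<forall>\<zeta>\<in>uncertainty_set T Dlo Dhi. (\<Sum>s=1..T+1. a s * \<zeta> s) \<le> b) \<longleftrightarrow> support a \<le> b"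
  unfolding uncertainty_set_def by (rule box_support_le_iff) (rule Dlo_le_Dhi)

lemma robust_ge_iff:
  "(\<forall>\<zeta>\<in>uncertainty_set T Dlo Dhi. b \<le> (\<Sum>s=1..T+1. a s * \<zeta> s)) \<longleftrightarrow>
    support (\<lambda>s. - a s) \<le> - b"
  unfolding robust_le_iff[symmetric] by (simp add: sum_negf del: sum.cl_ivl_Suc)

text \<open>
  A lower bound on a linear function over the box is an upper bound on its negative, so the whole
  problem is expressed through support functions: this gives closedness of the feasible set as well
  as the local constancy used for the count.
\<close>

lemma feasible_iff:
  "feasible (rule_of x) \<longleftrightarrow>
    (\<forall>e\<in>{1..E}. support (total_coeff x e) \<le> Q e) \<and>
    (\<forall>e\<in>{1..E}. \<forall>t\<in>{1..T}. support (\<lambda>s. - prod_coeff x t e s) \<le> 0 \<and>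
       support (prod_coeff x t e) \<le> p t e) \<and>
    (\<forall>t\<in>{1..T}. support (\<lambda>s. - inv_coeff x t s) \<le> v1 - Vmin \<and>
       support (inv_coeff x t) \<le> Vmax - v1)"
proof -
  have "(\<forall>e\<in>{1..E}. support (total_coeff x e) \<le> Q e) \<longleftrightarrow>
      (\<forall>\<zeta>\<in>uncertainty_set T Dlo Dhi. \<forall>e\<in>{1..E}. (\<Sum>t=1..T. production (rule_of x) \<zeta> t e) \<le> Q e)"
    unfolding total_production_eq robust_le_iff[symmetric] by blast
  moreover have "(\<forall>e\<in>{1..E}. \<forall>t\<in>{1..T}. support (\<lambda>s. - prod_coeff x t e s) \<le> 0 \<and>
       support (prod_coeff x t e) \<le> p t e) \<longleftrightarrow>
      (\<forall>\<zeta>\<in>uncertainty_set T Dlo Dhi. \<forall>e\<in>{1..E}. \<forall>t\<in>{1..T}.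
        0 \<le> production (rule_of x) \<zeta> t e \<and> production (rule_of x) \<zeta> t e \<le> p t e)"
  proof -
    have "support (\<lambda>s. - prod_coeff x t e s) \<le> 0 \<longleftrightarrow>
        (\<forall>\<zeta>\<in>uncertainty_set T Dlo Dhi. 0 \<le> production (rule_of x) \<zeta> t e)"
      "support (prod_coeff x t e) \<le> p t e \<longleftrightarrow>
        (\<forall>\<zeta>\<in>uncertainty_set T Dlo Dhi. production (rule_of x) \<zeta> t e \<le> p t e)"
      if "t \<in> {1..T}" for t e
      using that robust_ge_iff[of 0 "prod_coeff x t e"]
        robust_le_iff[of "prod_coeff x t e" "p t e"]
      by (simp_all add: production_eq del: sum.cl_ivl_Suc)
    then show ?thesis by blast
  qed
  moreover have "(\<forall>t\<in>{1..T}. support (\<lambda>s. - inv_coeff x t s) \<le> v1 - Vmin \<and>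
       support (inv_coeff x t) \<le> Vmax - v1) \<longleftrightarrow>
      (\<forall>\<zeta>\<in>uncertainty_set T Dlo Dhi. \<forall>t\<in>{1..T}.
        Vmin \<le> inventory E \<delta> v1 (rule_of x) \<zeta> t \<and> inventory E \<delta> v1 (rule_of x) \<zeta> t \<le> Vmax)"
  proof -
    have "support (\<lambda>s. - inv_coeff x t s) \<le> v1 - Vmin \<longleftrightarrow>
        (\<forall>\<zeta>\<in>uncertainty_set T Dlo Dhi. Vmin \<le> inventory E \<delta> v1 (rule_of x) \<zeta> t)"
      "support (inv_coeff x t) \<le> Vmax - v1 \<longleftrightarrow>
        (\<forall>\<zeta>\<in>uncertainty_set T Dlo Dhi. inventory E \<delta> v1 (rule_of x) \<zeta> t \<le> Vmax)"
      if "t \<in> {1..T}" for t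
      using that robust_ge_iff[of "Vmin - v1" "inv_coeff x t"]
        robust_le_iff[of "inv_coeff x t" "Vmax - v1"]
      by (simp_all add: inventory_eq algebra_simps del: sum.cl_ivl_Suc)
    then show ?thesis by blast
  qed
  ultimately show ?thesis
    unfolding ldr_feasible_def by blast
qed

lemma cost_eq: "cost (rule_of x) = support (cost_coeff x)"
proof -
  obtain \<zeta> where \<zeta>: "\<zeta> \<in> uncertainty_set T Dlo Dhi"
    "cost (rule_of x) = total_cost T E c (rule_of x) \<zeta>"
    "\<And>\<xi>. \<xi> \<in> uncertainty_set T Dlo Dhi \<Longrightarrow>
      total_cost T E c (rule_of x) \<xi> \<le> total_cost T E c (rule_of x) \<zeta>"
    using worst_case_cost_attained[of T Dlo Dhi E c "rule_of x"] Dlo_le_Dhi by blast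
  then have "support (cost_coeff x) \<le> cost (rule_of x)"
    using robust_le_iff[of "cost_coeff x" "cost (rule_of x)"] by (simp add: total_cost_eq del: sum.cl_ivl_Suc)
  moreover have "cost (rule_of x) \<le> support (cost_coeff x)"
    using robust_le_iff[of "cost_coeff x" "support (cost_coeff x)"] \<zeta>(1,2)
    by (simp add: total_cost_eq del: sum.cl_ivl_Suc)
  ultimately show ?thesis by simp
qed

section \<open>Production that arrives after the horizon\<close>

text \<open>
  The last period in which production can still influence an inventory constraint.
\<close>

definition horizon :: nat where
  "horizon = T - Min (\<delta> ` {1..E})"

definition active :: "(nat \<times> nat \<times> nat) set" where
  "active = {(t, s, e). 1 \<le> s \<and> s \<le> t \<and> t \<le> horizon \<and> e \<in> {1..E}}"

definition truncate_rule :: "(nat \<Rightarrow> nat \<Rightarrow> nat \<Rightarrow> real) \<Rightarrow> nat \<times> nat \<times> nat \<Rightarrow> real" where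
  "truncate_rule y = (\<lambda>(t, s, e). if (t, s, e) \<in> active then y t s e else 0)"

lemma horizon_le: "horizon \<le> T"
  by (simp add: horizon_def)

lemma finite_active: "finite active"
  by (rule finite_subset[of _ "{..horizon} \<times> {..horizon} \<times> {1..E}"]) (auto simp: active_def)

lemma arrival_le_horizon:
  assumes "e \<in> {1..E}" "t \<le> T"
  shows "t - \<delta> e \<le> horizon"
proof -
  have "Min (\<delta> ` {1..E}) \<le> \<delta> e" using assms(1) by (intro Min_le) auto
  with assms(2) show ?thesis by (simp add: horizon_def)
qed

lemma production_truncate:
  assumes "e \<in> {1..E}"
  shows "production (rule_of (truncate_rule y)) \<zeta> t e =
    (if t \<le> horizon then production y \<zeta> t e else 0)"
  unfolding production_def truncate_rule_def using assms
  by (auto simp: active_def intro!: sum.cong sum.neutral)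

lemma feasible_truncate:
  assumes "feasible y"
  shows "feasible (rule_of (truncate_rule y))"
  unfolding ldr_feasible_def
proof (intro ballI conjI)
  fix \<zeta> assume \<zeta>: "\<zeta> \<in> uncertainty_set T Dlo Dhi"
  note y = assms[unfolded ldr_feasible_def, rule_format, OF \<zeta>]
  have bounds: "0 \<le> production y \<zeta> t e" "production y \<zeta> t e \<le> p t e"
    if "e \<in> {1..E}" "t \<in> {1..T}" for t e
    using y that by blast+
  { fix e assume e: "e \<in> {1..E}"
    have "(\<Sum>t=1..T. production (rule_of (truncate_rule y)) \<zeta> t e) \<le> (\<Sum>t=1..T. production y \<zeta> t e)"
      using bounds(1)[OF e] by (intro sum_mono) (simp add: production_truncate[OF e])
    also have "\<dots> \<le> Q e" using y e by blast
    finally show "(\<Sum>t=1..T. production (rule_of (truncate_rule y)) \<zeta> t e) \<le> Q e" . }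
  { fix e t assume e: "e \<in> {1..E}" and t: "t \<in> {1..T}"
    show "0 \<le> production (rule_of (truncate_rule y)) \<zeta> t e"
      "production (rule_of (truncate_rule y)) \<zeta> t e \<le> p t e"
      using bounds[OF e t] by (simp_all add: production_truncate[OF e]) }
  { fix t assume t: "t \<in> {1..T}"
    have "(\<Sum>e=1..E. \<Sum>l=1..t - \<delta> e. production (rule_of (truncate_rule y)) \<zeta> l e) =
        (\<Sum>e=1..E. \<Sum>l=1..t - \<delta> e. production y \<zeta> l e)"
    proof (intro sum.cong refl)
      fix e l assume e: "e \<in> {1..E}" and "l \<in> {1..t - \<delta> e}"
      with t arrival_le_horizon[OF e, of t] have "l \<le> horizon" by simp
      then show "production (rule_of (truncate_rule y)) \<zeta> l e = production y \<zeta> l e"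
        by (simp add: production_truncate[OF e])
    qed
    then have "inventory E \<delta> v1 (rule_of (truncate_rule y)) \<zeta> t = inventory E \<delta> v1 y \<zeta> t"
      by (simp add: inventory_def)
    then show "Vmin \<le> inventory E \<delta> v1 (rule_of (truncate_rule y)) \<zeta> t"
      "inventory E \<delta> v1 (rule_of (truncate_rule y)) \<zeta> t \<le> Vmax"
      using y t by auto }
qed

lemma cost_truncate_le:
  assumes "feasible y"
  shows "cost (rule_of (truncate_rule y)) \<le> cost y"
proof -
  obtain \<zeta>' where \<zeta>': "cost y = total_cost T E c y \<zeta>'"
      "\<And>\<xi>. \<xi> \<in> uncertainty_set T Dlo Dhi \<Longrightarrow> total_cost T E c y \<xi> \<le> total_cost T E c y \<zeta>'"
    using worst_case_cost_attained[of T Dlo Dhi E c y] Dlo_le_Dhi by blast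
  obtain \<zeta> where \<zeta>: "\<zeta> \<in> uncertainty_set T Dlo Dhi"
      "cost (rule_of (truncate_rule y)) = total_cost T E c (rule_of (truncate_rule y)) \<zeta>"
    using worst_case_cost_attained[of T Dlo Dhi E c "rule_of (truncate_rule y)"] Dlo_le_Dhi
    by blast
  have "0 \<le> production y \<zeta> t e" if "e \<in> {1..E}" "t \<in> {1..T}" for t e
    using assms \<zeta>(1) that unfolding ldr_feasible_def by blast
  then have "total_cost T E c (rule_of (truncate_rule y)) \<zeta> \<le> total_cost T E c y \<zeta>"
    unfolding total_cost_def
    by (intro sum_mono mult_left_mono) (auto simp: production_truncate c_pos less_imp_le)
  with \<zeta>'(2)[OF \<zeta>(1)] \<zeta>(2) \<zeta>'(1) show ?thesis by simp
qed

section \<open>An extreme point among the optimal rules\<close>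

definition active_feasible :: "(nat \<times> nat \<times> nat \<Rightarrow> real) set" where
  "active_feasible = {x. feasible (rule_of x) \<and> (\<forall>i. i \<notin> active \<longrightarrow> x i = 0)}"

lemma truncate_active_feasible: "feasible y \<Longrightarrow> truncate_rule y \<in> active_feasible"
  unfolding active_feasible_def using feasible_truncate
  by (auto simp: truncate_rule_def)

text \<open>
  For \<open>s \<ge> 2\<close> the interval of \<open>\<zeta> s\<close> has positive length, so the range \<open>[0, p t e]\<close> of the production
  bounds the coefficient by \<open>coefficient_bound\<close>. The coefficient of \<open>\<zeta> 1 = 1\<close> is then bounded
  because production at the lower corner of the box lies in \<open>[0, p t e]\<close>.
\<close>

lemma active_feasible_bounded:
  obtains b where "\<And>x i. x \<in> active_feasible \<Longrightarrow> i \<in> active \<Longrightarrow> \<bar>x i\<bar> \<le> b i"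
proof
  define w where "w t e s = p t e / (Dhi s - Dlo s)" for t e s
  define b where "b = (\<lambda>(t, s, e).
    if s = 1 then p t e + (\<Sum>r=2..T+1. w t e r * \<bar>Dlo r\<bar>) else w t e s)"
  fix x i assume x: "x \<in> active_feasible" and i: "i \<in> active"
  obtain t s e where i_eq: "i = (t, s, e)" by (cases i)
  with i have ts: "1 \<le> s" "s \<le> t" "t \<in> {1..T}" "e \<in> {1..E}"
    using horizon_le by (auto simp: active_def)
  let ?a = "prod_coeff x t e"
  have up: "support ?a \<le> p t e" and low: "support (\<lambda>s. - ?a s) \<le> 0"
    using x ts(3,4) by (auto simp: active_feasible_def feasible_iff)
  have later: "\<bar>?a r\<bar> \<le> w t e r" if "r \<in> {2..T+1}" for r
  proof -
    have "\<bar>?a r\<bar> * (Dhi r - Dlo r) \<le> p t e + 0"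
      using that by (intro coefficient_bound[OF Dlo_le_Dhi _ up low]) auto
    then show ?thesis
      using D_less[OF that] by (simp add: w_def pos_le_divide_eq)
  qed
  have first: "\<bar>?a 1\<bar> \<le> p t e + (\<Sum>r=2..T+1. w t e r * \<bar>Dlo r\<bar>)"
  proof -
    let ?\<zeta> = "restrict Dlo {1..T+1}"
    have U: "?\<zeta> \<in> uncertainty_set T Dlo Dhi"
      using Dlo_le_Dhi by (auto simp: uncertainty_set_def)
    have "(\<Sum>r=1..T+1. ?a r * ?\<zeta> r) \<le> p t e" "0 \<le> (\<Sum>r=1..T+1. ?a r * ?\<zeta> r)"
      using up low robust_le_iff[of ?a "p t e", THEN iffD2, rule_format, OF _ U]
        robust_ge_iff[of 0 ?a, THEN iffD2, rule_format, OF _ U] by linarith+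
    moreover have "(\<Sum>r=1..T+1. ?a r * ?\<zeta> r) = ?a 1 + (\<Sum>r=2..T+1. ?a r * Dlo r)"
    proof -
      have "{1..T+1} = insert 1 {2..T+1}" by auto
      then show ?thesis using Dlo_1 by (simp del: sum.cl_ivl_Suc)
    qed
    moreover have "\<bar>\<Sum>r=2..T+1. ?a r * Dlo r\<bar> \<le> (\<Sum>r=2..T+1. w t e r * \<bar>Dlo r\<bar>)"
      by (rule order.trans[OF sum_abs])
        (intro sum_mono, simp add: abs_mult later mult_right_mono del: sum.cl_ivl_Suc)
    ultimately show ?thesis by linarith
  qed
  show "\<bar>x i\<bar> \<le> b i"
  proof (cases "s = 1")
    case True
    with first ts show ?thesis by (simp add: i_eq b_def prod_coeff_def)
  next
    case False
    with later[of s] ts show ?thesis by (simp add: i_eq b_def prod_coeff_def)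
  qed
qed

text \<open>
  A closed subset of a product of compact intervals; outside \<open>active\<close> the factor is \<open>{0}\<close>.
\<close>

lemma compact_active_feasible: "compact active_feasible"
proof -
  obtain b where b: "\<And>x i. x \<in> active_feasible \<Longrightarrow> i \<in> active \<Longrightarrow> \<bar>x i\<bar> \<le> b i"
    by (rule active_feasible_bounded) blast
  define box where "box = (\<Pi>\<^sub>E i\<in>UNIV. if i \<in> active then {- b i..b i} else {0})"
  have "compactin (product_topology (\<lambda>_. euclidean) UNIV) box"
    unfolding box_def compactin_PiE by simp
  then have "compact box"
    by (simp add: euclidean_product_topology)
  moreover have "closed {x. feasible (rule_of x)}"
  proof -
    have neg: "continuous_on UNIV (\<lambda>x. support (\<lambda>s. - prod_coeff x t e s))"
      "continuous_on UNIV (\<lambda>x. support (\<lambda>s. - inv_coeff x t s))" for t e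
      by (intro continuous_on_box_support continuous_intros continuous_on_coeffs)+
    show ?thesis
      unfolding feasible_iff Ball_def
      by (intro closed_Collect_conj closed_Collect_all closed_Collect_imp closed_Collect_le
          open_Collect_const continuous_on_const neg continuous_on_box_support continuous_on_coeffs)
  qed
  moreover have "active_feasible = box \<inter> {x. feasible (rule_of x)}"
  proof (intro equalityI subsetI)
    fix x assume x: "x \<in> active_feasible"
    then have "x i \<in> (if i \<in> active then {- b i..b i} else {0})" for i
      using b[OF x, of i] x by (cases "i \<in> active") (simp_all add: active_feasible_def abs_le_iff del: split_paired_All)
    with x show "x \<in> box \<inter> {x. feasible (rule_of x)}"
      by (simp add: box_def PiE_iff active_feasible_def)
  next
    fix x assume "x \<in> box \<inter> {x. feasible (rule_of x)}"
    then have "feasible (rule_of x)" and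
        box: "\<And>i. x i \<in> (if i \<in> active then {- b i..b i} else {0})"
      by (simp_all add: box_def PiE_iff del: split_paired_All)
    moreover have "x i = 0" if "i \<notin> active" for i using box[of i] that by simp
    ultimately show "x \<in> active_feasible" by (simp add: active_feasible_def)
  qed
  ultimately show ?thesis by (simp add: compact_Int_closed)
qed

text \<open>
  The last property is extremality. It is obtained by choosing, among the optimal rules, one that
  maximizes the strictly convex function \<open>\<Sum>i. (x i)\<^sup>2\<close>: if \<open>x + k d\<close> and \<open>x - k d\<close> are both
  optimal, the parallelogram identity makes one of them longer than \<open>x\<close> unless \<open>d = 0\<close>.
\<close>

lemma extreme_optimal_rule:
  assumes "\<exists>y. feasible y"
  obtains x where "x \<in> active_feasible" and "\<And>y. feasible y \<Longrightarrow> cost (rule_of x) \<le> cost y"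
    and "\<And>d. (\<And>i. i \<notin> active \<Longrightarrow> d i = 0) \<Longrightarrow>
      \<forall>\<^sub>F k in nhds 0. feasible (rule_of (\<lambda>i. x i + k * d i)) \<and>
        cost (rule_of (\<lambda>i. x i + k * d i)) = cost (rule_of x) \<Longrightarrow>
      d = (\<lambda>i. 0)"
proof -
  have cont: "continuous_on A (\<lambda>x. cost (rule_of x))" for A
    unfolding cost_eq by (intro continuous_on_box_support continuous_on_coeffs)
  have ne: "active_feasible \<noteq> {}"
    using assms truncate_active_feasible by blast
  obtain x0 where x0: "x0 \<in> active_feasible"
    "\<And>x. x \<in> active_feasible \<Longrightarrow> cost (rule_of x0) \<le> cost (rule_of x)"
    using continuous_attains_inf[OF compact_active_feasible ne cont] by blast
  define opt where "opt = active_feasible \<inter> {x. cost (rule_of x) \<le> cost (rule_of x0)}"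
  have "closed {x. cost (rule_of x) \<le> cost (rule_of x0)}"
    by (intro closed_Collect_le cont continuous_on_const)
  then have "compact opt"
    unfolding opt_def by (intro compact_Int_closed compact_active_feasible)
  moreover have "opt \<noteq> {}" using x0(1) by (auto simp: opt_def)
  moreover have "continuous_on opt (\<lambda>x. \<Sum>i\<in>active. (x i)\<^sup>2)"
    by (intro continuous_intros continuous_on_subset[OF continuous_on_product_coordinates]) simp
  ultimately obtain x where x: "x \<in> opt"
    and x_max: "\<And>z. z \<in> opt \<Longrightarrow> (\<Sum>i\<in>active. (z i)\<^sup>2) \<le> (\<Sum>i\<in>active. (x i)\<^sup>2)"
    using continuous_attains_sup[of opt "\<lambda>x. \<Sum>i\<in>active. (x i)\<^sup>2"] by blast
  show thesis
  proof
    show xf: "x \<in> active_feasible" using x by (simp add: opt_def)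
    show "cost (rule_of x) \<le> cost y" if "feasible y" for y
      using x x0(2)[OF truncate_active_feasible[OF that]] cost_truncate_le[OF that]
      by (simp add: opt_def)
    fix d :: "nat \<times> nat \<times> nat \<Rightarrow> real"
    assume d: "\<And>i. i \<notin> active \<Longrightarrow> d i = 0"
      and ev: "\<forall>\<^sub>F k in nhds 0. feasible (rule_of (\<lambda>i. x i + k * d i)) \<and>
        cost (rule_of (\<lambda>i. x i + k * d i)) = cost (rule_of x)"
    obtain r where r: "r > 0" "\<And>k. dist k 0 < r \<Longrightarrow> feasible (rule_of (\<lambda>i. x i + k * d i)) \<and>
        cost (rule_of (\<lambda>i. x i + k * d i)) = cost (rule_of x)"
      using ev unfolding eventually_nhds_metric by blast
    have "(\<lambda>i. x i + k * d i) \<in> opt" if "dist k 0 < r" for k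
      using r(2)[OF that] x d by (auto simp: opt_def active_feasible_def)
    then have "(\<Sum>i\<in>active. (x i + k * d i)\<^sup>2) \<le> (\<Sum>i\<in>active. (x i)\<^sup>2)" if "dist k 0 < r" for k
      using x_max that by blast
    from this[of "r/2"] this[of "- (r/2)"] r(1)
    have "(\<Sum>i\<in>active. (x i + r/2 * d i)\<^sup>2) + (\<Sum>i\<in>active. (x i + - (r/2) * d i)\<^sup>2)
        \<le> 2 * (\<Sum>i\<in>active. (x i)\<^sup>2)"
      by (simp add: dist_real_def)
    moreover have "(\<Sum>i\<in>active. (x i + r/2 * d i)\<^sup>2) + (\<Sum>i\<in>active. (x i + - (r/2) * d i)\<^sup>2)
        = 2 * (\<Sum>i\<in>active. (x i)\<^sup>2) + r\<^sup>2 / 2 * (\<Sum>i\<in>active. (d i)\<^sup>2)"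
      unfolding sum.distrib[symmetric] sum_distrib_left
      by (intro sum.cong refl) (simp add: power2_eq_square field_simps)
    ultimately have "(\<Sum>i\<in>active. (d i)\<^sup>2) \<le> 0"
      using r(1) by (simp add: mult_le_0_iff)
    then have "(\<Sum>i\<in>active. (d i)\<^sup>2) = 0"
      by (intro antisym sum_nonneg) auto
    then have "d i = 0" if "i \<in> active" for i
      using that by (simp add: sum_nonneg_eq_0_iff finite_active)
    with d show "d = (\<lambda>i. 0)" by (intro ext) blast
  qed
qed

section \<open>Counting the equations that keep a rule optimal\<close>

lemma inactive_coeffs:
  assumes "\<And>i. i \<notin> active \<Longrightarrow> d i = 0" and "s \<notin> {1..horizon}"
  shows "prod_coeff d t e s = 0" "total_coeff d e s = 0" "cost_coeff d s = 0"
    "delivered_coeff d t s = 0"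
proof -
  show z: "prod_coeff d t e s = 0" for t e
    using assms by (auto simp: prod_coeff_def active_def)
  then show "total_coeff d e s = 0" "cost_coeff d s = 0" "delivered_coeff d t s = 0"
    by (simp_all add: total_coeff_def cost_coeff_def delivered_coeff_def)
qed

text \<open>
  The homogeneous equations on a direction \<open>d\<close> under which all support functions of the problem
  are locally constant. In \<open>d_cost\<close> and \<open>d_total\<close> the coefficients of \<open>d\<close> vanish altogether;
  this takes only \<open>horizon\<close> equations for the cost and for each facility. In \<open>d_tight\<close> the index
  \<open>s\<close> starts at \<open>2\<close>, because the interval of \<open>\<zeta> 1\<close> is a point, and the value \<open>1\<close> is where the
  delivered quantity offsets the coefficient of the demand \<open>\<zeta> s\<close>.
\<close>

lemma feasible_cost_locally_constant:
  assumes x: "x \<in> active_feasible"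
    and supp: "\<And>i. i \<notin> active \<or> x i = 0 \<Longrightarrow> d i = 0"
    and d_cost: "\<And>s. s \<in> {1..horizon} \<Longrightarrow> cost_coeff d s = 0"
    and d_total: "\<And>e s. e \<in> {1..E} \<Longrightarrow> s \<in> {1..horizon} \<Longrightarrow> total_coeff d e s = 0"
    and d_prod: "\<And>e t. e \<in> {1..E} \<Longrightarrow> t \<in> {1..horizon} \<Longrightarrow>
      (\<Sum>s=1..T+1. prod_coeff d t e s * corner Dlo Dhi (prod_coeff x t e) s) = 0 \<and>
      (\<Sum>s=1..T+1. prod_coeff d t e s * corner Dlo Dhi (\<lambda>s. - prod_coeff x t e s) s) = 0"
    and d_inv: "\<And>t. t \<in> {1..T} \<Longrightarrow>
      (\<Sum>s=1..T+1. delivered_coeff d t s * corner Dlo Dhi (inv_coeff x t) s) = 0 \<and>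
      (\<Sum>s=1..T+1. delivered_coeff d t s * corner Dlo Dhi (\<lambda>s. - inv_coeff x t s) s) = 0"
    and d_tight: "\<And>t s. t \<in> {1..T} \<Longrightarrow> s \<in> {2..horizon} \<Longrightarrow> delivered_coeff x t s = 1 \<Longrightarrow>
      delivered_coeff d t s = 0"
  shows "\<forall>\<^sub>F k in nhds 0. feasible (rule_of (\<lambda>i. x i + k * d i)) \<and>
    cost (rule_of (\<lambda>i. x i + k * d i)) = cost (rule_of x)"
proof -
  have inactive: "\<And>i. i \<notin> active \<Longrightarrow> d i = 0" using supp by blast
  let ?z = "\<lambda>k i. x i + k * d i"
  note coeff_add = linear_form_coeffs[THEN linear_form_add]
  have inv_add: "inv_coeff (?z k) t s = inv_coeff x t s + k * delivered_coeff d t s" for k t s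
    by (simp add: inv_coeff_def coeff_add)
  have const: "\<forall>\<^sub>F k in nhds 0. support (\<lambda>s. a s + k * g s) = support a"
    if "\<And>s. s \<in> {2..T+1} \<Longrightarrow> a s = 0 \<Longrightarrow> g s = 0"
      "(\<Sum>s=1..T+1. g s * corner Dlo Dhi a s) = 0" for a g
  proof (rule box_support_locally_constant[OF Dlo_le_Dhi _ that(2)])
    fix s assume "s \<in> {1..T+1}" "Dlo s < Dhi s" "a s = 0"
    moreover from this have "s \<noteq> 1" using Dlo_1 Dhi_1 by auto
    ultimately show "g s = 0" by (intro that(1)) auto
  qed
  have const_neg: "\<forall>\<^sub>F k in nhds 0. support (\<lambda>s. - (a s + k * g s)) = support (\<lambda>s. - a s)"
    if "\<And>s. s \<in> {2..T+1} \<Longrightarrow> a s = 0 \<Longrightarrow> g s = 0"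
      "(\<Sum>s=1..T+1. g s * corner Dlo Dhi (\<lambda>s. - a s) s) = 0" for a g
    using const[of "\<lambda>s. - a s" "\<lambda>s. - g s"] that
    by (simp add: sum_negf del: sum.cl_ivl_Suc)
  have "cost_coeff d s = 0" for s
    using d_cost inactive_coeffs(3)[of d, OF inactive] by blast
  then have "cost_coeff (?z k) = cost_coeff x" for k
    by (simp add: coeff_add fun_eq_iff)
  then have ev_cost: "cost (rule_of (?z k)) = cost (rule_of x)" for k
    unfolding cost_eq[of "?z k"] cost_eq[of x] by simp
  have "total_coeff d e s = 0" if "e \<in> {1..E}" for e s
    using d_total[OF that] inactive_coeffs(2)[of d, OF inactive] by blast
  then have total: "total_coeff (?z k) e = total_coeff x e" if "e \<in> {1..E}" for k e
    using that by (simp add: coeff_add fun_eq_iff)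
  have vanish_prod: "prod_coeff d t e s = 0" if "prod_coeff x t e s = 0" for t e s
    using that supp by (auto simp: prod_coeff_def)
  have late: "prod_coeff d t e s = 0" if "t \<notin> {1..horizon}" for t e s
    using that inactive by (auto simp: prod_coeff_def active_def)
  have ev_prod: "\<forall>\<^sub>F k in nhds 0. \<forall>e\<in>{1..E}. \<forall>t\<in>{1..T}.
      support (prod_coeff (?z k) t e) = support (prod_coeff x t e) \<and>
      support (\<lambda>s. - prod_coeff (?z k) t e s) = support (\<lambda>s. - prod_coeff x t e s)"
  proof (intro eventually_ball_finite ballI eventually_conj finite_atLeastAtMost)
    fix e t assume e: "e \<in> {1..E}"
    have ortho: "(\<Sum>s=1..T+1. prod_coeff d t e s * corner Dlo Dhi (prod_coeff x t e) s) = 0"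
      "(\<Sum>s=1..T+1. prod_coeff d t e s * corner Dlo Dhi (\<lambda>s. - prod_coeff x t e s) s) = 0"
      using d_prod[OF e] late by (cases "t \<in> {1..horizon}"; simp)+
    have add: "prod_coeff (?z k) t e = (\<lambda>s. prod_coeff x t e s + k * prod_coeff d t e s)" for k
      by (rule ext) (rule coeff_add)
    show "\<forall>\<^sub>F k in nhds 0. support (prod_coeff (?z k) t e) = support (prod_coeff x t e)"
      unfolding add by (rule const[OF vanish_prod ortho(1)])
    show "\<forall>\<^sub>F k in nhds 0. support (\<lambda>s. - prod_coeff (?z k) t e s) =
        support (\<lambda>s. - prod_coeff x t e s)"
      unfolding add by (rule const_neg[OF vanish_prod ortho(2)])
  qed
  have ev_inv: "\<forall>\<^sub>F k in nhds 0. \<forall>t\<in>{1..T}.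
      support (inv_coeff (?z k) t) = support (inv_coeff x t) \<and>
      support (\<lambda>s. - inv_coeff (?z k) t s) = support (\<lambda>s. - inv_coeff x t s)"
  proof (intro eventually_ball_finite ballI eventually_conj finite_atLeastAtMost)
    fix t assume t: "t \<in> {1..T}"
    have vanish: "delivered_coeff d t s = 0" if s: "s \<in> {2..T+1}" "inv_coeff x t s = 0" for s
      \<comment> \<open>For \<open>s > t\<close> nothing that depends on \<open>\<zeta> s\<close> has been produced by period \<open>t\<close>.\<close>
    proof (cases "s \<le> t")
      case True
      with s have "delivered_coeff x t s = 1" by (simp add: inv_coeff_def)
      then show ?thesis
        using d_tight[OF t] inactive_coeffs(4)[of d, OF inactive] s(1) by (cases "s \<le> horizon") auto
    next
      case False
      then show ?thesis
        by (auto simp: delivered_coeff_def prod_coeff_def intro!: sum.neutral)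
    qed
    have add: "inv_coeff (?z k) t = (\<lambda>s. inv_coeff x t s + k * delivered_coeff d t s)" for k
      by (rule ext) (rule inv_add)
    show "\<forall>\<^sub>F k in nhds 0. support (inv_coeff (?z k) t) = support (inv_coeff x t)"
      unfolding add by (rule const[OF vanish d_inv[OF t, THEN conjunct1]])
    show "\<forall>\<^sub>F k in nhds 0. support (\<lambda>s. - inv_coeff (?z k) t s) = support (\<lambda>s. - inv_coeff x t s)"
      unfolding add by (rule const_neg[OF vanish d_inv[OF t, THEN conjunct2]])
  qed
  from x have "feasible (rule_of x)" by (simp add: active_feasible_def)
  then have x_feasible: "\<forall>e\<in>{1..E}. support (total_coeff x e) \<le> Q e"
    "\<forall>e\<in>{1..E}. \<forall>t\<in>{1..T}. support (\<lambda>s. - prod_coeff x t e s) \<le> 0 \<and>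
       support (prod_coeff x t e) \<le> p t e"
    "\<forall>t\<in>{1..T}. support (\<lambda>s. - inv_coeff x t s) \<le> v1 - Vmin \<and>
       support (inv_coeff x t) \<le> Vmax - v1"
    unfolding feasible_iff by blast+
  from ev_prod ev_inv show ?thesis
  proof eventually_elim
    case (elim k)
    have "feasible (rule_of (?z k))"
      unfolding feasible_iff[of "?z k"] using x_feasible elim total by simp
    with ev_cost show ?case by blast
  qed
qed

text \<open>
  Written as a sum over entries, the delivered coefficient for period \<open>t\<close> has a summation range
  that grows with \<open>t\<close>. This is the chain to which the counting argument applies.
\<close>

lemma delivered_coeff_eq_sum:
  assumes S: "S \<subseteq> active" and z: "\<And>i. i \<notin> S \<Longrightarrow> z i = 0"
  shows "delivered_coeff z t s =
    sum z {i \<in> S. fst (snd i) = s \<and> fst i + \<delta> (snd (snd i)) \<le> t}" (is "_ = sum z ?B")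
proof -
  let ?P = "Sigma {1..E} (\<lambda>e. {1..t - \<delta> e})" and ?f = "\<lambda>(e, l). (l, s, e)"
  have "prod_coeff z l e s = z (l, s, e)" for l e
    using S z[of "(l, s, e)"] by (auto simp: prod_coeff_def active_def)
  then have "delivered_coeff z t s = (\<Sum>(e, l)\<in>?P. z (l, s, e))"
    unfolding delivered_coeff_def by (simp add: sum.Sigma)
  also have "\<dots> = sum z (?f ` ?P)"
    by (subst sum.reindex) (auto simp: inj_on_def intro!: sum.cong)
  also have "\<dots> = sum z ?B"
  proof (rule sum.mono_neutral_right)
    show "?B \<subseteq> ?f ` ?P"
    proof
      fix i assume i: "i \<in> ?B"
      obtain l r e where i_eq: "i = (l, r, e)" by (cases i)
      with i S have "l \<ge> 1" "e \<in> {1..E}" "r = s" "l + \<delta> e \<le> t"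
        by (auto simp: active_def)
      then show "i \<in> ?f ` ?P" unfolding i_eq by force
    qed
    show "\<forall>i\<in>?f ` ?P - ?B. z i = 0" using z by auto
  qed auto
  finally show ?thesis .
qed

text \<open>
  \<open>F\<close> collects the equations of \<open>feasible_cost_locally_constant\<close>. The equations from vanishing
  inventory coefficients are indexed by the sets \<open>B t s\<close> and not by the periods \<open>t\<close>: periods with
  the same set give the same equation, and only the number of distinct sets is controlled by
  the number of nonzero entries.
\<close>

lemma extreme_support_bound:
  assumes x: "x \<in> active_feasible"
    and extreme: "\<And>d. (\<And>i. i \<notin> active \<Longrightarrow> d i = 0) \<Longrightarrow>
      \<forall>\<^sub>F k in nhds 0. feasible (rule_of (\<lambda>i. x i + k * d i)) \<and>
        cost (rule_of (\<lambda>i. x i + k * d i)) = cost (rule_of x) \<Longrightarrow>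
      d = (\<lambda>i. 0)"
  shows "card {i. x i \<noteq> 0} \<le> 3 * horizon + 4 * T + 6 * E * horizon"
proof -
  define S where "S = {i. x i \<noteq> 0}"
  have S_active: "S \<subseteq> active"
    using x unfolding S_def active_feasible_def by blast
  then have fin: "finite S" using finite_active finite_subset by blast
  define B where "B t s = {i \<in> S. fst (snd i) = s \<and> fst i + \<delta> (snd (snd i)) \<le> t}" for t s
  define \<B> where "\<B> s = {B t s |t. t \<in> {1..T} \<and> delivered_coeff x t s = 1}" for s
  define S_at where "S_at s = {i \<in> S. fst (snd i) = s}" for s
  have delivered: "delivered_coeff z t s = sum z (B t s)" if "\<And>i. i \<notin> S \<Longrightarrow> z i = 0" for z t s
    unfolding B_def by (rule delivered_coeff_eq_sum[OF S_active that])
  have fin_\<B>: "finite (\<B> s)" for s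
    unfolding \<B>_def by simp
  have tight_count: "2 * card (\<B> s) \<le> card (S_at s) + 1" for s
  proof (rule card_chain_equal_sums[where w = x and r = 1])
    show "A \<subseteq> A' \<or> A' \<subseteq> A" if "A \<in> \<B> s" "A' \<in> \<B> s" for A A'
    proof -
      have "B t s \<subseteq> B t' s" if "t \<le> t'" for t t'
        using that by (auto simp: B_def)
      then show ?thesis
        using that unfolding \<B>_def by (smt (verit) mem_Collect_eq nat_le_linear)
    qed
    show "sum x A = 1" if "A \<in> \<B> s" for A
      using that delivered[of x] by (auto simp: \<B>_def S_def)
  qed (use fin in \<open>auto simp: S_at_def \<B>_def B_def S_def\<close>)

  define Fcost where "Fcost = (\<lambda>s d. cost_coeff d s) ` {1..horizon}"
  define Ftotal where "Ftotal = (\<lambda>(e, s) d. total_coeff d e s) ` ({1..E} \<times> {1..horizon})"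
  define Fprod where "Fprod = (\<lambda>(e, t) d. \<Sum>s=1..T+1. prod_coeff d t e s *
    corner Dlo Dhi (prod_coeff x t e) s) ` ({1..E} \<times> {1..horizon})"
  define Fprod' where "Fprod' = (\<lambda>(e, t) d. \<Sum>s=1..T+1. prod_coeff d t e s *
    corner Dlo Dhi (\<lambda>s. - prod_coeff x t e s) s) ` ({1..E} \<times> {1..horizon})"
  define Finv where "Finv = (\<lambda>t d. \<Sum>s=1..T+1. delivered_coeff d t s *
    corner Dlo Dhi (inv_coeff x t) s) ` {1..T}"
  define Finv' where "Finv' = (\<lambda>t d. \<Sum>s=1..T+1. delivered_coeff d t s *
    corner Dlo Dhi (\<lambda>s. - inv_coeff x t s) s) ` {1..T}"
  define Ftight where "Ftight = (\<Union>s\<in>{2..horizon}. (\<lambda>A d. sum d A :: real) ` \<B> s)"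
  define F where "F = Fcost \<union> (Ftotal \<union> (Fprod \<union> (Fprod' \<union> (Finv \<union> (Finv' \<union> Ftight)))))"
  note F_defs = Fcost_def Ftotal_def Fprod_def Fprod'_def Finv_def Finv'_def Ftight_def
  have "finite F"
    unfolding F_def F_defs using fin_\<B> by simp
  have lin: "linear_form \<phi>" if "\<phi> \<in> F" for \<phi>
    using that unfolding F_def F_defs
    by (auto intro!: linear_form_intros linear_form_coeffs simp del: sum.cl_ivl_Suc)

  have "card S \<le> card F"
  proof (rule ccontr)
    assume "\<not> card S \<le> card F"
    then obtain d where d: "\<exists>i. d i \<noteq> 0" "\<And>i. i \<notin> S \<Longrightarrow> d i = 0" "\<And>\<phi>. \<phi> \<in> F \<Longrightarrow> \<phi> d = 0"
      using small_system_nontrivial_kernel[OF \<open>finite F\<close> fin _ lin] by (metis not_le)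
    have "\<forall>\<^sub>F k in nhds 0. feasible (rule_of (\<lambda>i. x i + k * d i)) \<and>
        cost (rule_of (\<lambda>i. x i + k * d i)) = cost (rule_of x)"
    proof (rule feasible_cost_locally_constant[OF x])
      show "d i = 0" if "i \<notin> active \<or> x i = 0" for i
        using that S_active d(2)[of i] unfolding S_def by blast
      show "cost_coeff d s = 0" if "s \<in> {1..horizon}" for s
        using that by (intro d(3)[of "\<lambda>d. cost_coeff d s"]) (auto simp: F_def Fcost_def)
      show "total_coeff d e s = 0" if "e \<in> {1..E}" "s \<in> {1..horizon}" for e s
        using that by (intro d(3)[of "\<lambda>d. total_coeff d e s"]) (force simp: F_def Ftotal_def)
      show "(\<Sum>s=1..T+1. prod_coeff d t e s * corner Dlo Dhi (prod_coeff x t e) s) = 0 \<and>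
          (\<Sum>s=1..T+1. prod_coeff d t e s * corner Dlo Dhi (\<lambda>s. - prod_coeff x t e s) s) = 0"
        if "e \<in> {1..E}" "t \<in> {1..horizon}" for e t
      proof
        have "(\<lambda>d. \<Sum>s=1..T+1. prod_coeff d t e s * corner Dlo Dhi (prod_coeff x t e) s) \<in> F"
          unfolding F_def Fprod_def using that
          by (intro UnI2 UnI1 image_eqI[of _ _ "(e, t)"]) auto
        from d(3)[OF this] show
          "(\<Sum>s=1..T+1. prod_coeff d t e s * corner Dlo Dhi (prod_coeff x t e) s) = 0" .
        have "(\<lambda>d. \<Sum>s=1..T+1. prod_coeff d t e s *
            corner Dlo Dhi (\<lambda>s. - prod_coeff x t e s) s) \<in> F"
          unfolding F_def Fprod'_def using that
          by (intro UnI2 UnI1 image_eqI[of _ _ "(e, t)"]) auto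
        from d(3)[OF this] show "(\<Sum>s=1..T+1. prod_coeff d t e s *
            corner Dlo Dhi (\<lambda>s. - prod_coeff x t e s) s) = 0" .
      qed
      show "(\<Sum>s=1..T+1. delivered_coeff d t s * corner Dlo Dhi (inv_coeff x t) s) = 0 \<and>
          (\<Sum>s=1..T+1. delivered_coeff d t s * corner Dlo Dhi (\<lambda>s. - inv_coeff x t s) s) = 0"
        if "t \<in> {1..T}" for t
      proof
        have "(\<lambda>d. \<Sum>s=1..T+1. delivered_coeff d t s * corner Dlo Dhi (inv_coeff x t) s) \<in> F"
          unfolding F_def Finv_def using that by blast
        from d(3)[OF this] show
          "(\<Sum>s=1..T+1. delivered_coeff d t s * corner Dlo Dhi (inv_coeff x t) s) = 0" .
        have "(\<lambda>d. \<Sum>s=1..T+1. delivered_coeff d t s *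
            corner Dlo Dhi (\<lambda>s. - inv_coeff x t s) s) \<in> F"
          unfolding F_def Finv'_def using that by blast
        from d(3)[OF this] show "(\<Sum>s=1..T+1. delivered_coeff d t s *
            corner Dlo Dhi (\<lambda>s. - inv_coeff x t s) s) = 0" .
      qed
      show "delivered_coeff d t s = 0"
        if "t \<in> {1..T}" "s \<in> {2..horizon}" "delivered_coeff x t s = 1" for t s
      proof -
        have "B t s \<in> \<B> s" using that unfolding \<B>_def by blast
        then have "(\<lambda>d. sum d (B t s)) \<in> F"
          using that(2) unfolding F_def Ftight_def by blast
        from d(3)[OF this] show ?thesis using delivered[of d] d(2) by simp
      qed
    qed
    with extreme[of d] S_active d(2) have "d = (\<lambda>i. 0)" by blast
    with d(1) show False by simp
  qed

  moreover have "card F \<le> horizon + (E * horizon + (E * horizon + (E * horizon +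
      (T + (T + (\<Sum>s=2..horizon. card (\<B> s)))))))"
  proof -
    have "card Ftight \<le> (\<Sum>s=2..horizon. card (\<B> s))"
      unfolding Ftight_def
      by (intro order.trans[OF card_UN_le] sum_mono card_image_le fin_\<B> finite_atLeastAtMost)
    moreover have "card Fcost \<le> horizon" "card Finv \<le> T" "card Finv' \<le> T"
      unfolding F_defs using card_image_le[of "{1..horizon}"] card_image_le[of "{1..T}"] by force+
    moreover have "card Ftotal \<le> E * horizon" "card Fprod \<le> E * horizon" "card Fprod' \<le> E * horizon"
      unfolding F_defs
      by (rule order.trans[OF card_image_le], simp, simp)+
    ultimately show ?thesis
      unfolding F_def by (intro order.trans[OF card_Un_le] add_mono) assumption+
  qed
  moreover have "2 * (\<Sum>s=2..horizon. card (\<B> s)) \<le> card S + horizon"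
  proof -
    have "2 * (\<Sum>s=2..horizon. card (\<B> s)) \<le> (\<Sum>s=2..horizon. card (S_at s) + 1)"
      unfolding sum_distrib_left by (intro sum_mono tight_count)
    also have "\<dots> = card (\<Union>s\<in>{2..horizon}. S_at s) + (horizon - 1)"
      by (subst card_UN_disjoint) (auto simp: sum_Suc S_at_def fin)
    also have "\<dots> \<le> card S + horizon"
      by (intro add_mono card_mono fin) (auto simp: S_at_def)
    finally show ?thesis .
  qed
  ultimately show ?thesis
    unfolding S_def[symmetric] by (simp add: algebra_simps)
qed

end

theorem theorem1:
  fixes T E :: nat
    and \<delta> :: "nat \<Rightarrow> nat"
    and c p :: "nat \<Rightarrow> nat \<Rightarrow> real"
    and Q :: "nat \<Rightarrow> real"
    and Vmin Vmax v1 :: real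
    and Dlo Dhi :: "nat \<Rightarrow> real"
  assumes "T \<ge> 1" and "E \<ge> 1"
    and "Min (\<delta> ` {1..E}) \<le> T"
    and "\<And>t e. t \<in> {1..T} \<Longrightarrow> e \<in> {1..E} \<Longrightarrow> c t e > 0"
    and "Dlo 1 = 1" and "Dhi 1 = 1"
    and "\<And>t. t \<in> {2..T+1} \<Longrightarrow> Dlo t < Dhi t"
    and "\<exists>y. ldr_feasible T E \<delta> p Q Vmin Vmax v1 Dlo Dhi y"
    and "\<bar>ldr_value T E \<delta> c p Q Vmin Vmax v1 Dlo Dhi\<bar> \<noteq> \<infinity>"
  shows "\<exists>y. ldr_optimal T E \<delta> c p Q Vmin Vmax v1 Dlo Dhi y \<and>
    l0_norm T E y \<le> 2 + 8 * E + 10 * T + 6 * E * (T - Min (\<delta> ` {1..E}))"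
proof -
  interpret production_inventory T E \<delta> c p Q Vmin Vmax v1 Dlo Dhi
    by unfold_locales (fact assms(4-7))+
  obtain x where x: "x \<in> active_feasible" and opt: "\<And>y. feasible y \<Longrightarrow> cost (rule_of x) \<le> cost y"
    and extreme: "\<And>d. (\<And>i. i \<notin> active \<Longrightarrow> d i = 0) \<Longrightarrow>
      \<forall>\<^sub>F k in nhds 0. feasible (rule_of (\<lambda>i. x i + k * d i)) \<and>
        cost (rule_of (\<lambda>i. x i + k * d i)) = cost (rule_of x) \<Longrightarrow>
      d = (\<lambda>i. 0)"
    by (rule extreme_optimal_rule[OF assms(8)]) blast
  have "feasible (rule_of x)"
    using x by (simp add: active_feasible_def)
  then have "ldr_optimal T E \<delta> c p Q Vmin Vmax v1 Dlo Dhi (rule_of x)"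
    unfolding ldr_optimal_def is_arg_min_linorder using opt by blast
  moreover have "l0_norm T E (rule_of x) \<le> 2 + 8 * E + 10 * T + 6 * E * horizon"
  proof -
    have "{i. x i \<noteq> 0} \<subseteq> active"
      using x unfolding active_feasible_def by blast
    then have "finite {i. x i \<noteq> 0}"
      using finite_active finite_subset by blast
    then have "l0_norm T E (rule_of x) \<le> card {i. x i \<noteq> 0}"
      unfolding l0_norm_def by (rule card_mono) auto
    also have "\<dots> \<le> 3 * horizon + 4 * T + 6 * E * horizon"
      by (rule extreme_support_bound[OF x extreme])
    also have "\<dots> \<le> 2 + 8 * E + 10 * T + 6 * E * horizon"
      using horizon_le by simp
    finally show ?thesis .
  qed
  ultimately show ?thesis
    unfolding horizon_def by blast
qed

end
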